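(* Let $f_1,f_2\in\mathbb{F}_{q^m}\langle X^q\rangle$ be coprime linearized polynomials of $q$-degrees $d_1,d_2$ respectively, and let $S_1,S_2\in\mathbb{F}_{q^m}\langle X^q\rangle$ satisfy $S_1\circ f_1+S_2\circ f_2=X$ with $\deg_q(S_1)<d_2$ and $\deg_q(S_2)<d_1$. If $g\in\mathbb{F}_{q^m}\langle X^q\rangle$ has $q$-degree strictly less than $d_1+d_2$, then $$\pi_{1,2}\bigl(\pi_2(g)\circ S_1\circ f_1+\pi_1(g)\circ S_2\circ f_2\bigr)=g.$$
   Context: Let $q$ be a prime power and $m\ge1$. $\mathbb{F}_{q^m}\langle X^q\rangle$ is the set of linearized polynomials $\sum_{i=0}^d p_iX^{q^i}$, $p_i\in\mathbb{F}_{q^m}$, a non-commutative ring under addition and composition $\circ$, determined by $(aX^{q^i})\circ(bX^{q^j})=ab^{q^i}X^{q^{i+j}}$; its unit element is $X$. The $q$-degree $\deg_q(P)$ of a nonzero $P$ is the largest $i$ such that the coefficient of $X^{q^i}$ is nonzero (and $\deg_q(0)=-\infty$). For $B\neq0$, right division of $A$ by $B$ is the unique writing $A=Q\circ B+R$ with $\deg_q R<\deg_q B$; $R$ is the remainder. $A\wedge_r B$ denotes the greatest right common divisor, $A\vee_l B$ the least left common multiple (a generator of the intersection of the left ideals generated by $A$ and $B$); $A$ and $B$ are coprime if $A\wedge_r B=X$ (up to a nonzero scalar). $\pi_i(g)$ denotes the remainder of the right division of $g$ by $f_i$ ($i=1,2$), and $\pi_{1,2}(g)$ the remainder of the right division of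 $g$ by $f_1\vee_l f_2$. *)

theory Defs
  imports
    "HOL-Number_Theory.Prime_Powers"
    "HOL-Computational_Algebra.Polynomial"
    "HOL-Library.Extended_Real"
    "HOL-Library.Cardinality"
begin

text \<open>
  Linearized polynomials are ordinary univariate polynomials whose monomials have exponents
  \<open>q ^ i\<close>; their product is substitution \<open>\<circ>\<^sub>p\<close> and the unit element is \<open>[:0, 1:]\<close>.
  The coefficient field of order \<open>q ^ m\<close> is a type of class field and finite.
\<close>

definition linearized :: "nat \<Rightarrow> 'a::field poly set" where
  "linearized q = {P. \<exists>d p. P = (\<Sum>i\<le>d. monom (p i) (q ^ i))}"

lemma monom_pcompose_monom:
  "monom a (q ^ i) \<circ>\<^sub>p monom b (q ^ j) = monom (a * b ^ (q ^ i)) (q ^ (i + j))"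
  for a b :: "'a::field"
proof -
  have "monom a n \<circ>\<^sub>p p = smult a (p ^ n)" for n and p :: "'a poly"
    by (induction n) (simp_all add: monom_0 monom_Suc pcompose_pCons)
  then show ?thesis
    by (simp add: monom_power smult_monom power_add mult.commute)
qed

definition qdeg :: "nat \<Rightarrow> 'a::field poly \<Rightarrow> ereal" where
  "qdeg q P = (if P = 0 then -\<infinity> else ereal (real (Max {i. coeff P (q ^ i) \<noteq> 0})))"

text \<open>The remainder is only meaningful for linearized \<open>A\<close> and nonzero linearized \<open>B\<close>.\<close>

definition right_rem :: "nat \<Rightarrow> 'a::field poly \<Rightarrow> 'a poly \<Rightarrow> 'a poly" where
  "right_rem q A B = (THE R. R \<in> linearized q \<and> qdeg q R < qdeg q B \<and>
     (\<exists>Q \<in> linearized q. A = Q \<circ>\<^sub>p B + R))"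

definition right_dvd :: "nat \<Rightarrow> 'a::field poly \<Rightarrow> 'a poly \<Rightarrow> bool" where
  "right_dvd q D A \<longleftrightarrow> (\<exists>Q \<in> linearized q. A = Q \<circ>\<^sub>p D)"

definition is_gcrd :: "nat \<Rightarrow> 'a::field poly \<Rightarrow> 'a poly \<Rightarrow> 'a poly \<Rightarrow> bool" where
  "is_gcrd q D A B \<longleftrightarrow> D \<in> linearized q \<and> right_dvd q D A \<and> right_dvd q D B \<and>
     (\<forall>E \<in> linearized q. right_dvd q E A \<and> right_dvd q E B \<longrightarrow> right_dvd q E D)"

definition left_ideal :: "nat \<Rightarrow> 'a::field poly \<Rightarrow> 'a poly set" where
  "left_ideal q A = {Q \<circ>\<^sub>p A | Q. Q \<in> linearized q}"

definition is_lclm :: "nat \<Rightarrow> 'a::field poly \<Rightarrow> 'a poly \<Rightarrow> 'a poly \<Rightarrow> bool" where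
  "is_lclm q M A B \<longleftrightarrow> M \<in> linearized q \<and> left_ideal q M = left_ideal q A \<inter> left_ideal q B"

text \<open>
  Both are determined only up to a nonzero scalar factor on the left; an arbitrary representative
  is chosen.
\<close>

definition gcrd :: "nat \<Rightarrow> 'a::field poly \<Rightarrow> 'a poly \<Rightarrow> 'a poly" where
  "gcrd q A B = (SOME D. is_gcrd q D A B)"

definition lclm :: "nat \<Rightarrow> 'a::field poly \<Rightarrow> 'a poly \<Rightarrow> 'a poly" where
  "lclm q A B = (SOME M. is_lclm q M A B)"

definition right_coprime :: "nat \<Rightarrow> 'a::field poly \<Rightarrow> 'a poly \<Rightarrow> bool" where
  "right_coprime q A B \<longleftrightarrow> (\<exists>c. c \<noteq> 0 \<and> gcrd q A B = smult c [:0, 1:])"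

end

theory Submission
  imports Defs
begin

text \<open>
  Since \<open>S1 \<circ>\<^sub>p f1 + S2 \<circ>\<^sub>p f2\<close> is the unit, \<open>f2 \<circ>\<^sub>p S1 \<circ>\<^sub>p f1 = f2 - f2 \<circ>\<^sub>p S2 \<circ>\<^sub>p f2\<close> lies in both left
  ideals, and so does \<open>f1 \<circ>\<^sub>p S2 \<circ>\<^sub>p f2\<close>; hence the argument of the outer remainder differs from
  \<open>g\<close> by an element of the left ideal of \<open>lclm f1 f2\<close>. It remains to see that the \<open>q\<close>-degree \<open>e\<close>
  of the lclm is at least \<open>d1 + d2\<close>: by the same computation every pair of remainders modulo
  \<open>f1\<close> and \<open>f2\<close> is realised by some linearized polynomial of \<open>q\<close>-degree less than \<open>e\<close>, and one counts.
\<close>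

text \<open>
  \<open>HOL-Number_Theory.Residues\<close> has this fact too, but its \<open>monom\<close> and \<open>coeff\<close> shadow those of
  \<open>Polynomial\<close>. Idea: \<open>x \<mapsto> x + 1\<close> permutes the ring.
\<close>

lemma CHAR_dvd_CARD: "CHAR('a::{ring_1, finite}) dvd CARD('a)"
proof -
  have "(\<Sum>x\<in>UNIV. x + 1) = (\<Sum>x\<in>UNIV. x :: 'a)"
    by (rule sum.reindex_bij_witness[of _ "\<lambda>x. x - 1" "\<lambda>x. x + 1"]) auto
  then have "of_nat CARD('a) = (0 :: 'a)"
    by (simp add: sum.distrib)
  then show ?thesis by (simp add: of_nat_eq_0_iff_char_dvd)
qed

section \<open>Linearized polynomials described by their support\<close>

lemma coeff_sum_monom_power:
  fixes p :: "nat \<Rightarrow> 'a::comm_monoid_add"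
  assumes "q \<ge> 2"
  shows "coeff (\<Sum>i<d. monom (p i) (q ^ i)) (q ^ j) = (if j < d then p j else 0)"
proof -
  have "coeff (\<Sum>i<d. monom (p i) (q ^ i)) (q ^ j) = (\<Sum>i<d. if i = j then p i else 0)"
    using assms by (auto simp: coeff_sum intro!: sum.cong)
  then show ?thesis by simp
qed

lemma coeff_sum_monom_nonpower:
  assumes "\<nexists>j. n = q ^ j"
  shows "coeff (\<Sum>i<d. monom (p i) (q ^ i)) n = 0"
  using assms by (auto simp: coeff_sum intro!: sum.neutral)

lemma linearized_expansion:
  assumes "q \<ge> 2" and "\<And>n. coeff P n \<noteq> 0 \<Longrightarrow> \<exists>i. n = q ^ i" and "degree P < q ^ d"
  shows "P = (\<Sum>i<d. monom (coeff P (q ^ i)) (q ^ i))"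
proof (rule poly_eqI)
  fix n
  show "coeff P n = coeff (\<Sum>i<d. monom (coeff P (q ^ i)) (q ^ i)) n"
  proof (cases "\<exists>j. n = q ^ j")
    case True
    then obtain j where n: "n = q ^ j" by blast
    have "coeff P (q ^ j) = 0" if "\<not> j < d"
    proof -
      have "q ^ d \<le> q ^ j" using that assms(1) by (intro power_increasing) auto
      then show ?thesis using assms(3) by (intro coeff_eq_0) simp
    qed
    then show ?thesis by (simp add: n coeff_sum_monom_power[OF assms(1)])
  next
    case False
    then show ?thesis using coeff_sum_monom_nonpower assms(2) by metis
  qed
qed

text \<open>A condition on the support turns closure properties into coefficientwise checks, free of
  any choice of expansion length.\<close>

lemma linearized_iff:
  assumes "q \<ge> 2"
  shows "P \<in> linearized q \<longleftrightarrow> (\<forall>n. coeff P n \<noteq> 0 \<longrightarrow> (\<exists>i. n = q ^ i))"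
proof
  assume "P \<in> linearized q"
  then obtain d p where P: "P = (\<Sum>i<Suc d. monom (p i) (q ^ i))"
    unfolding linearized_def lessThan_Suc_atMost by blast
  show "\<forall>n. coeff P n \<noteq> 0 \<longrightarrow> (\<exists>i. n = q ^ i)"
    using coeff_sum_monom_nonpower unfolding P by metis
next
  assume *: "\<forall>n. coeff P n \<noteq> 0 \<longrightarrow> (\<exists>i. n = q ^ i)"
  \<comment> \<open>By \<open>n < 2 ^ n\<close> the degree itself is a long enough expansion length.
    The successor appears because the sum in \<open>linearized\<close> includes its upper
    end.\<close>
  have "degree P < q ^ degree P"
    using assms by (intro less_exp[THEN less_le_trans] power_mono) auto
  also have "\<dots> \<le> q ^ Suc (degree P)"
    using assms by simp
  finally have "P = (\<Sum>i<Suc (degree P). monom (coeff P (q ^ i)) (q ^ i))"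
    using * assms by (intro linearized_expansion) auto
  then show "P \<in> linearized q"
    unfolding linearized_def lessThan_Suc_atMost by (intro CollectI exI)
qed

section \<open>The ring of linearized polynomials under composition\<close>

text \<open>The parameter \<open>field_type\<close> ties \<open>'a\<close> to the numerical
  parameters. Since \<open>q\<close> is a power of the prime characteristic, raising to the power
  \<open>q ^ i\<close> is additive.\<close>

locale linearized_ring =
  fixes q k :: nat and field_type :: "'a::field itself"
  assumes prime_char: "prime CHAR('a)" and q_eq: "q = CHAR('a) ^ k" and k_pos: "k > 0"
begin

abbreviation L :: "'a poly set" where
  "L \<equiv> linearized q"

lemma q_ge_2: "q \<ge> 2"
proof -
  have "2 \<le> CHAR('a)" using prime_char by (rule prime_ge_2_nat)
  also have "\<dots> \<le> CHAR('a) ^ k"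
    using k_pos prime_char by (intro self_le_power) (auto dest: prime_ge_1_nat)
  finally show ?thesis by (simp add: q_eq)
qed

lemma q_simps [simp]: "0 < q" "q \<noteq> 0" "Suc 0 < q" "q \<noteq> Suc 0"
  using q_ge_2 by simp_all

lemma power_q_pos: "q ^ i > 0"
  by simp

lemmas L_iff = linearized_iff[OF q_ge_2]

lemma zero_L [simp]: "0 \<in> L"
  by (simp add: L_iff)

lemma monom_L [simp]: "monom a (q ^ i) \<in> L"
  by (auto simp: L_iff split: if_splits)

lemma X_L [simp]: "[:0, 1:] \<in> L"
  using monom_L[of 1 0] by (simp add: monom_altdef)

lemma add_L: "P \<in> L \<Longrightarrow> Q \<in> L \<Longrightarrow> P + Q \<in> L"
  by (auto simp: L_iff) (metis add_0)

lemma uminus_L: "P \<in> L \<Longrightarrow> - P \<in> L"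
  by (auto simp: L_iff)

lemma diff_L: "P \<in> L \<Longrightarrow> Q \<in> L \<Longrightarrow> P - Q \<in> L"
  using add_L[of P "- Q"] uminus_L by simp

lemma sum_L: "(\<And>i. i \<in> I \<Longrightarrow> f i \<in> L) \<Longrightarrow> sum f I \<in> L"
  by (induction I rule: infinite_finite_induct) (auto intro: add_L)

lemma coeff_0_L: "P \<in> L \<Longrightarrow> coeff P 0 = 0"
  using power_q_pos by (fastforce simp: L_iff)

lemma pcompose_0_right_L: "P \<in> L \<Longrightarrow> P \<circ>\<^sub>p 0 = 0"
  by (simp add: pcompose_0' coeff_0_L)

lemma degree_0_L: "P \<in> L \<Longrightarrow> degree P = 0 \<Longrightarrow> P = 0"
  using coeff_0_L by (metis leading_coeff_0_iff)

lemma degree_L: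
  assumes "P \<in> L" "P \<noteq> 0"
  shows "\<exists>i. degree P = q ^ i"
  using assms by (auto simp: L_iff)

lemma L_expansionE:
  assumes "P \<in> L"
  obtains d p where "P = (\<Sum>i\<le>d. monom (p i) (q ^ i))"
  using assms unfolding linearized_def by blast

text \<open>Composition is always additive in its left argument; on the right it is the freshman's
  dream, applied to each monomial of \<open>P\<close>.\<close>

lemma pcompose_add_right:
  fixes A B :: "'a poly"
  assumes "P \<in> L"
  shows "P \<circ>\<^sub>p (A + B) = P \<circ>\<^sub>p A + P \<circ>\<^sub>p B"
proof -
  have monom: "monom a n \<circ>\<^sub>p Q = smult a (Q ^ n)" for a :: 'a and n Q
    by (induction n) (simp_all add: monom_0 monom_Suc pcompose_pCons)
  have "(A + B) ^ q ^ i = A ^ q ^ i + B ^ q ^ i" for i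
    using prime_char by (intro freshmans_dream'[where n = "k * i"]) (auto simp: q_eq power_mult)
  moreover obtain d p where "P = (\<Sum>i\<le>d. monom (p i) (q ^ i))"
    using assms by (rule L_expansionE)
  ultimately show ?thesis
    by (simp add: pcompose_sum monom smult_add_right sum.distrib)
qed

lemma pcompose_sum_right:
  fixes f :: "'b \<Rightarrow> 'a poly"
  assumes "P \<in> L"
  shows "P \<circ>\<^sub>p sum f I = (\<Sum>i\<in>I. P \<circ>\<^sub>p f i)"
  by (induction I rule: infinite_finite_induct)
     (simp_all add: pcompose_add_right[OF assms] pcompose_0_right_L[OF assms])

text \<open>Additivity on both sides reduces the claim to the composition of two monomials.\<close>

lemma pcompose_L:
  assumes "P \<in> L" "Q \<in> L"
  shows "P \<circ>\<^sub>p Q \<in> L"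
proof -
  obtain d p where Q: "Q = (\<Sum>i\<le>d. monom (p i) (q ^ i))"
    using assms(2) by (rule L_expansionE)
  obtain e r where P: "P = (\<Sum>i\<le>e. monom (r i) (q ^ i))"
    using assms(1) by (rule L_expansionE)
  have "P \<circ>\<^sub>p monom (p j) (q ^ j) \<in> L" for j
    unfolding P pcompose_sum by (intro sum_L) (simp add: monom_pcompose_monom)
  then show ?thesis
    unfolding Q pcompose_sum_right[OF assms(1)] by (intro sum_L)
qed

section \<open>Trading q-degrees for ordinary degrees, which multiply under composition\<close>

lemma qdeg_eq:
  assumes "P \<in> L" "P \<noteq> 0" "degree P = q ^ i"
  shows "qdeg q P = ereal (real i)"
proof -
  have "coeff P (q ^ i) \<noteq> 0" using assms by (metis leading_coeff_0_iff)
  moreover have "j \<le> i" if "coeff P (q ^ j) \<noteq> 0" for j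
    using le_degree[OF that] assms(3) by simp
  ultimately have "Max {j. coeff P (q ^ j) \<noteq> 0} = i"
    by (intro Max_eqI) (auto intro: finite_subset[of _ "{..i}"])
  then show ?thesis using assms(2) by (simp add: qdeg_def)
qed

lemma qdeg_eq_iff:
  assumes "P \<in> L"
  shows "qdeg q P = ereal (real i) \<longleftrightarrow> P \<noteq> 0 \<and> degree P = q ^ i"
proof (cases "P = 0")
  case True
  then show ?thesis by (simp add: qdeg_def)
next
  case False
  then obtain j where "degree P = q ^ j" using degree_L assms by blast
  with False show ?thesis
    using qdeg_eq[OF assms] by (metis ereal.inject of_nat_eq_iff)
qed

lemma qdeg_less_iff:
  assumes "P \<in> L"
  shows "qdeg q P < ereal (real d) \<longleftrightarrow> degree P < q ^ d"
proof (cases "P = 0")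
  \<comment> \<open>At zero the conventions differ, minus infinity against 0, but both values lie
    below the bound.\<close>
  case True
  then show ?thesis by (simp add: qdeg_def)
next
  case False
  then obtain i where "degree P = q ^ i" using degree_L assms by blast
  with False show ?thesis using qdeg_eq[OF assms] by simp
qed

lemma qdeg_less_qdeg_iff:
  assumes "P \<in> L" "B \<in> L" "B \<noteq> 0"
  shows "qdeg q P < qdeg q B \<longleftrightarrow> degree P < degree B"
  using assms degree_L qdeg_eq qdeg_less_iff by metis

section \<open>Right division with remainder\<close>

lemma right_division_exists:
  assumes "A \<in> L" "B \<in> L" "B \<noteq> 0"
  shows "\<exists>Q\<in>L. \<exists>R\<in>L. degree R < degree B \<and> A = Q \<circ>\<^sub>p B + R"
  using assms(1)
proof (induction "degree A" arbitrary: A rule: less_induct)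
  case less
  show ?case
  proof (cases "degree A < degree B")
    case True
    then show ?thesis using less.prems by (intro bexI[of _ 0] bexI[of _ A]) auto
  next
    case False
    obtain b where b: "degree B = q ^ b" using degree_L assms by blast
    then have "A \<noteq> 0" using False by auto
    then obtain a where a: "degree A = q ^ a" using degree_L less.prems by blast
    have ab: "b \<le> a" using False a b by simp
    \<comment> \<open>Composing \<open>monom c (q ^ n)\<close> with \<open>B\<close> raises the
      leading coefficient of \<open>B\<close> to the power \<open>q ^ n\<close>; this
      \<open>c\<close> compensates, so \<open>M \<circ>\<^sub>p B\<close> cancels the leading term
      of \<open>A\<close>.\<close>
    define c where "c = lead_coeff A / lead_coeff B ^ q ^ (a - b)"
    define M where "M = monom c (q ^ (a - b))"
    have "c \<noteq> 0" using \<open>A \<noteq> 0\<close> assms by (simp add: c_def)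
    then have degM: "degree M = q ^ (a - b)" by (simp add: M_def degree_monom_eq)
    have deg: "degree (M \<circ>\<^sub>p B) = degree A"
      using ab by (simp add: degree_pcompose degM a b flip: power_add)
    have "lead_coeff (M \<circ>\<^sub>p B) = lead_coeff M * lead_coeff B ^ degree M"
      using b by (intro lead_coeff_comp) simp
    also have "\<dots> = lead_coeff A"
      unfolding degM using assms(3) by (simp add: M_def c_def)
    finally have lead: "lead_coeff (M \<circ>\<^sub>p B) = lead_coeff A" .
    let ?A' = "A - M \<circ>\<^sub>p B"
    have M: "M \<in> L" by (simp add: M_def)
    have A': "?A' \<in> L" using less.prems assms M by (intro diff_L pcompose_L)
    have "degree ?A' \<le> degree A" using deg by (intro degree_diff_le) auto
    moreover have "coeff ?A' (degree A) = 0" using lead deg by simp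
    \<comment> \<open>Equal degrees would make the leading coefficient of \<open>?A'\<close> zero,
      hence \<open>?A' = 0\<close> of degree 0, whereas \<open>degree A\<close> is a power of
      \<open>q\<close>.\<close>
    ultimately have "degree ?A' < degree A"
      using a power_q_pos by (metis degree_0 leading_coeff_0_iff le_neq_implies_less)
    from less.hyps[OF this A'] obtain Q R where
      "Q \<in> L" "R \<in> L" "degree R < degree B" "?A' = Q \<circ>\<^sub>p B + R" by blast
    then show ?thesis
      using M by (intro bexI[of _ "Q + M"] bexI[of _ R]) (auto simp: pcompose_add add_L algebra_simps)
  qed
qed

text \<open>A nonzero \<open>Q - Q'\<close> has no constant term, so its degree is at least 1 and
  \<open>(Q - Q') \<circ>\<^sub>p B\<close> has degree at least that of \<open>B\<close>, too large
  for a difference of remainders.\<close>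

lemma right_division_unique:
  assumes "Q \<in> L" "Q' \<in> L"
    and "degree R < degree B" "degree R' < degree B" and "Q \<circ>\<^sub>p B + R = Q' \<circ>\<^sub>p B + R'"
  shows "R = R'"
proof -
  have eq: "(Q - Q') \<circ>\<^sub>p B = R' - R"
    using assms(5) by (simp add: pcompose_diff algebra_simps)
  have "degree (Q - Q') * degree B < degree B"
    using degree_diff_less[OF assms(4,3)] by (simp add: eq flip: degree_pcompose)
  then have "degree (Q - Q') = 0" by simp
  then have "Q - Q' = 0" using assms by (intro degree_0_L diff_L)
  then show ?thesis using eq by simp
qed

lemma right_rem_eqI:
  assumes "B \<in> L" "Q \<in> L" "R \<in> L" "degree R < degree B" and "A = Q \<circ>\<^sub>p B + R"
  shows "right_rem q A B = R"
proof -
  have "B \<noteq> 0" using assms by auto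
  then show ?thesis
    unfolding right_rem_def using assms right_division_unique
    by (intro the_equality) (auto simp: qdeg_less_qdeg_iff)
qed

lemma right_remE:
  assumes "A \<in> L" "B \<in> L" "B \<noteq> 0"
  obtains Q where "Q \<in> L" "right_rem q A B \<in> L" "degree (right_rem q A B) < degree B"
    "A = Q \<circ>\<^sub>p B + right_rem q A B"
proof -
  obtain Q R where "Q \<in> L" "R \<in> L" "degree R < degree B" "A = Q \<circ>\<^sub>p B + R"
    using right_division_exists[OF assms] by blast
  moreover from this have "right_rem q A B = R"
    using assms(2) by (intro right_rem_eqI)
  ultimately show ?thesis using that by simp
qed

section \<open>Left ideals and least left common multiples\<close>

lemma left_ideal_iff: "P \<in> left_ideal q A \<longleftrightarrow> (\<exists>Q\<in>L. P = Q \<circ>\<^sub>p A)"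
  by (auto simp: left_ideal_def)

lemma left_ideal_subset_L: "A \<in> L \<Longrightarrow> left_ideal q A \<subseteq> L"
  by (auto simp: left_ideal_def pcompose_L)

lemma left_ideal_generator: "A \<in> L \<Longrightarrow> A \<in> left_ideal q A"
  by (auto simp: left_ideal_iff intro!: bexI[of _ "[:0, 1:]"] simp: pcompose_pCons)

lemma left_ideal_diff:
  "P \<in> left_ideal q A \<Longrightarrow> P' \<in> left_ideal q A \<Longrightarrow> P - P' \<in> left_ideal q A"
  for A :: "'a poly"
  unfolding left_ideal_iff by (metis diff_L pcompose_diff)

lemma left_ideal_pcompose:
  "Q \<in> L \<Longrightarrow> P \<in> left_ideal q A \<Longrightarrow> Q \<circ>\<^sub>p P \<in> left_ideal q A"
  by (auto simp: left_ideal_iff pcompose_assoc intro!: pcompose_L)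

text \<open>Left ideals are principal by right division: a nonzero element of least degree generates
  the intersection, and 0 generates the trivial one. This gives the arbitrary choice in
  \<open>lclm\<close> its meaning.\<close>

lemma is_lclm_exists:
  assumes "A \<in> L" "B \<in> L"
  shows "\<exists>M. is_lclm q M A B"
proof -
  let ?I = "left_ideal q A \<inter> left_ideal q B"
  show ?thesis
  proof (cases "\<exists>P. P \<in> ?I \<and> P \<noteq> 0")
    case False
    moreover have "0 \<in> ?I" by (auto simp: left_ideal_iff intro!: bexI[of _ 0])
    ultimately have "?I = {0}" by blast
    moreover have "left_ideal q (0 :: 'a poly) = {0}"
      using pcompose_0_right_L left_ideal_generator[OF zero_L] by (auto simp: left_ideal_iff)
    ultimately show ?thesis by (intro exI[of _ 0]) (simp add: is_lclm_def)
  next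
    case True
    then obtain M where M: "M \<in> ?I" "M \<noteq> 0"
      and min: "\<And>P. P \<in> ?I \<Longrightarrow> P \<noteq> 0 \<Longrightarrow> degree M \<le> degree P"
      using ex_has_least_nat[of "\<lambda>P. P \<in> ?I \<and> P \<noteq> 0" _ degree] by blast
    have M_L: "M \<in> L" using M left_ideal_subset_L assms by blast
    have "?I \<subseteq> left_ideal q M"
    proof
      fix P assume P: "P \<in> ?I"
      then have "P \<in> L" using left_ideal_subset_L assms by blast
      then obtain Q R where QR: "Q \<in> L" "degree R < degree M" "P = Q \<circ>\<^sub>p M + R"
        using right_division_exists M_L M(2) by blast
      have "P - Q \<circ>\<^sub>p M \<in> ?I"
        using P M(1) QR(1) by (auto intro!: left_ideal_diff left_ideal_pcompose[of Q])
      then have "R \<in> ?I" using QR(3) by simp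
      then have "R = 0" using min QR by force
      then show "P \<in> left_ideal q M" using QR by (auto simp: left_ideal_iff)
    qed
    moreover have "left_ideal q M \<subseteq> ?I"
      using M left_ideal_pcompose by (auto simp: left_ideal_iff[of _ M])
    ultimately show ?thesis using M_L by (auto simp: is_lclm_def)
  qed
qed

lemma is_lclm_lclm: "A \<in> L \<Longrightarrow> B \<in> L \<Longrightarrow> is_lclm q (lclm q A B) A B"
  unfolding lclm_def by (rule someI_ex) (rule is_lclm_exists)

section \<open>Counting linearized polynomials of bounded q-degree\<close>

text \<open>For a divisor of q-degree \<open>d\<close> these are exactly the possible remainders,
  zero included.\<close>

definition L_below :: "nat \<Rightarrow> 'a poly set" where
  "L_below d = {P \<in> L. degree P < q ^ d}"

lemma card_L_below:
  assumes "finite (UNIV :: 'a set)"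
  shows "finite (L_below d)" and "card (L_below d) = CARD('a) ^ d"
proof -
  let ?f = "\<lambda>p. \<Sum>i<d. monom (p i) (q ^ i) :: 'a poly"
  \<comment> \<open>Extensional functions carry no values outside the \<open>d\<close> coefficient
    positions, which makes \<open>?f\<close> injective.\<close>
  let ?D = "{..<d} \<rightarrow>\<^sub>E (UNIV :: 'a set)"
  have "inj_on ?f ?D"
  proof (rule inj_onI)
    fix p p' assume p: "p \<in> ?D" "p' \<in> ?D" and eq: "?f p = ?f p'"
    show "p = p'"
    proof (rule PiE_ext[OF p])
      fix i assume "i \<in> {..<d}"
      then show "p i = p' i"
        using arg_cong[OF eq, of "\<lambda>P. coeff P (q ^ i)"] by (simp add: coeff_sum_monom_power q_ge_2)
    qed
  qed
  moreover have "L_below d = ?f ` ?D"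
  proof
    have "degree (?f p) < q ^ d" for p
    proof (rule degree_sum_less)
      fix i assume "i \<in> {..<d}"
      then show "degree (monom (p i) (q ^ i)) < q ^ d"
        by (intro le_less_trans[OF degree_monom_le]) simp
    qed simp
    moreover have "?f p \<in> L" for p
      by (intro sum_L monom_L)
    ultimately show "?f ` ?D \<subseteq> L_below d"
      unfolding L_below_def by blast
    show "L_below d \<subseteq> ?f ` ?D"
    proof
      fix P assume "P \<in> L_below d"
      then have "P = ?f (\<lambda>i. coeff P (q ^ i))"
        using q_ge_2 by (intro linearized_expansion) (auto simp: L_below_def L_iff)
      also have "\<dots> = ?f (restrict (\<lambda>i. coeff P (q ^ i)) {..<d})"
        by simp
      finally show "P \<in> ?f ` ?D"
        by (rule image_eqI[where x = "restrict (\<lambda>i. coeff P (q ^ i)) {..<d}"]) simp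
    qed
  qed
  ultimately have bij: "bij_betw ?f ?D (L_below d)"
    by (simp add: bij_betw_def)
  have "finite ?D" using assms by (simp add: finite_PiE)
  then show "finite (L_below d)" using bij_betw_finite[OF bij] by simp
  show "card (L_below d) = CARD('a) ^ d"
    using bij_betw_same_card[OF bij] by (simp add: card_PiE)
qed

end

section \<open>Chinese remaindering from a Bezout identity\<close>

locale linearized_bezout = linearized_ring q k field_type
  for q k and field_type :: "'a::field itself" +
  fixes f1 f2 S1 S2 :: "'a poly" and d1 d2 :: nat
  assumes f_L: "f1 \<in> L" "f2 \<in> L" and S_L: "S1 \<in> L" "S2 \<in> L"
    and degree_f: "degree f1 = q ^ d1" "degree f2 = q ^ d2"
    and bezout: "S1 \<circ>\<^sub>p f1 + S2 \<circ>\<^sub>p f2 = [:0, 1:]"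
begin

lemma f_nonzero: "f1 \<noteq> 0" "f2 \<noteq> 0"
  using degree_f power_q_pos by (metis degree_0 less_irrefl)+

lemma bezout_pcompose:
  assumes "P \<in> L"
  shows "P \<circ>\<^sub>p (S1 \<circ>\<^sub>p f1) + P \<circ>\<^sub>p (S2 \<circ>\<^sub>p f2) = P"
  using pcompose_add_right[OF assms, of "S1 \<circ>\<^sub>p f1" "S2 \<circ>\<^sub>p f2"] by (simp add: bezout)

text \<open>These common multiples absorb the error terms in \<open>crt_congruent\<close> and show
  in \<open>lclm_nonzero\<close> that the intersection is not trivial.\<close>

lemma crossed_in_ideals:
  shows "f2 \<circ>\<^sub>p (S1 \<circ>\<^sub>p f1) \<in> left_ideal q f1 \<inter> left_ideal q f2"
    and "f1 \<circ>\<^sub>p (S2 \<circ>\<^sub>p f2) \<in> left_ideal q f1 \<inter> left_ideal q f2"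
proof -
  have "f2 \<circ>\<^sub>p (S1 \<circ>\<^sub>p f1) = f2 - f2 \<circ>\<^sub>p (S2 \<circ>\<^sub>p f2)" "f1 \<circ>\<^sub>p (S2 \<circ>\<^sub>p f2) = f1 - f1 \<circ>\<^sub>p (S1 \<circ>\<^sub>p f1)"
    using bezout_pcompose f_L by (simp_all add: eq_diff_eq add.commute)
  moreover have "P \<circ>\<^sub>p (S1 \<circ>\<^sub>p f1) \<in> left_ideal q f1" "P \<circ>\<^sub>p (S2 \<circ>\<^sub>p f2) \<in> left_ideal q f2" if "P \<in> L" for P
    using that S_L f_L by (auto intro!: left_ideal_pcompose left_ideal_generator)
  ultimately show "f2 \<circ>\<^sub>p (S1 \<circ>\<^sub>p f1) \<in> left_ideal q f1 \<inter> left_ideal q f2"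
    and "f1 \<circ>\<^sub>p (S2 \<circ>\<^sub>p f2) \<in> left_ideal q f1 \<inter> left_ideal q f2"
    using f_L left_ideal_generator left_ideal_diff by (metis IntI)+
qed

lemma crt_congruent:
  assumes "P \<in> L"
  shows "right_rem q P f2 \<circ>\<^sub>p (S1 \<circ>\<^sub>p f1) + right_rem q P f1 \<circ>\<^sub>p (S2 \<circ>\<^sub>p f2) - P
    \<in> left_ideal q f1 \<inter> left_ideal q f2" (is "?H - P \<in> ?I")
proof -
  obtain Q1 where Q1: "Q1 \<in> L" "P = Q1 \<circ>\<^sub>p f1 + right_rem q P f1"
    using right_remE[OF assms f_L(1) f_nonzero(1)] by metis
  obtain Q2 where Q2: "Q2 \<in> L" "P = Q2 \<circ>\<^sub>p f2 + right_rem q P f2"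
    using right_remE[OF assms f_L(2) f_nonzero(2)] by metis
  have r: "right_rem q P f1 = P - Q1 \<circ>\<^sub>p f1" "right_rem q P f2 = P - Q2 \<circ>\<^sub>p f2"
    using Q1(2) Q2(2) by (simp_all add: algebra_simps)
  \<comment> \<open>The two terms containing \<open>P\<close> add up to \<open>P\<close> by the
    Bezout identity and cancel; only multiples of the crossed elements remain.\<close>
  have "?H - P = - (Q2 \<circ>\<^sub>p (f2 \<circ>\<^sub>p (S1 \<circ>\<^sub>p f1))) - Q1 \<circ>\<^sub>p (f1 \<circ>\<^sub>p (S2 \<circ>\<^sub>p f2))"
    unfolding r using bezout_pcompose[OF assms]
    by (simp add: pcompose_diff pcompose_assoc algebra_simps)
  also have "\<dots> = (- Q2) \<circ>\<^sub>p (f2 \<circ>\<^sub>p (S1 \<circ>\<^sub>p f1)) - Q1 \<circ>\<^sub>p (f1 \<circ>\<^sub>p (S2 \<circ>\<^sub>p f2))"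
    by (simp add: pcompose_uminus)
  also have "\<dots> \<in> ?I"
    using crossed_in_ideals Q1(1) Q2(1)
    by (auto intro!: left_ideal_diff left_ideal_pcompose[of "- Q2"] left_ideal_pcompose[of Q1] uminus_L)
  finally show ?thesis .
qed

text \<open>Modulo \<open>f1\<close>, \<open>S1 \<circ>\<^sub>p f1\<close> is 0 and
  \<open>S2 \<circ>\<^sub>p f2\<close> is the unit; modulo \<open>f2\<close> the roles are
  exchanged.\<close>

lemma crt_surjective:
  assumes "R1 \<in> L" "R2 \<in> L"
  defines "H \<equiv> R2 \<circ>\<^sub>p (S1 \<circ>\<^sub>p f1) + R1 \<circ>\<^sub>p (S2 \<circ>\<^sub>p f2)"
  shows "H \<in> L" "H - R1 \<in> left_ideal q f1" "H - R2 \<in> left_ideal q f2"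
proof -
  show "H \<in> L" unfolding H_def using assms f_L S_L by (intro add_L pcompose_L)
  have "H - R1 = (R2 - R1) \<circ>\<^sub>p (S1 \<circ>\<^sub>p f1)" "H - R2 = (R1 - R2) \<circ>\<^sub>p (S2 \<circ>\<^sub>p f2)"
    using bezout_pcompose[OF assms(1)] bezout_pcompose[OF assms(2)]
    by (simp_all add: H_def pcompose_diff algebra_simps)
  then show "H - R1 \<in> left_ideal q f1" "H - R2 \<in> left_ideal q f2"
    using assms S_L f_L by (auto intro!: left_ideal_pcompose left_ideal_generator diff_L)
qed

text \<open>If the intersection were trivial, both crossed elements would vanish. The first forces
  \<open>S1 = 0\<close>, as degrees multiply; then \<open>S2 \<circ>\<^sub>p f2\<close> is the unit
  and the second equals \<open>f1\<close>, which is nonzero.\<close>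

lemma lclm_nonzero:
  assumes "is_lclm q M f1 f2"
  shows "M \<noteq> 0"
proof
  assume M: "M = 0"
  have "left_ideal q (0 :: 'a poly) \<subseteq> {0}"
    using pcompose_0_right_L by (auto simp: left_ideal_def)
  then have zero: "P = 0" if "P \<in> left_ideal q f1" "P \<in> left_ideal q f2" for P
    using that assms M by (auto simp: is_lclm_def)
  have "f2 \<circ>\<^sub>p (S1 \<circ>\<^sub>p f1) = 0"
    using crossed_in_ideals(1) zero by blast
  then have "(f2 \<circ>\<^sub>p S1) \<circ>\<^sub>p f1 = 0" by (simp add: pcompose_assoc)
  then have "f2 \<circ>\<^sub>p S1 = 0" by (rule pcompose_eq_0) (simp add: degree_f)
  then have "degree f2 * degree S1 = 0" by (simp flip: degree_pcompose)
  then have "S1 = 0" using degree_f S_L degree_0_L by simp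
  then have "f1 \<circ>\<^sub>p (S2 \<circ>\<^sub>p f2) = f1" using bezout by simp
  then show False using crossed_in_ideals(2) zero f_nonzero by (metis IntE)
qed

lemma degree_lclm_ge:
  assumes fin: "finite (UNIV :: 'a set)" and M: "is_lclm q M f1 f2"
  shows "q ^ (d1 + d2) \<le> degree M"
proof -
  have M_L: "M \<in> L" and M0: "M \<noteq> 0" and
    ideal: "left_ideal q M = left_ideal q f1 \<inter> left_ideal q f2"
    using M lclm_nonzero by (auto simp: is_lclm_def)
  obtain e where e: "degree M = q ^ e" using degree_L M_L M0 by blast
  let ?rems = "\<lambda>P. (right_rem q P f1, right_rem q P f2)"
  have "L_below d1 \<times> L_below d2 \<subseteq> ?rems ` L_below e"
  proof safe
    fix R1 R2 assume "R1 \<in> L_below d1" "R2 \<in> L_below d2"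
    then have R: "R1 \<in> L" "degree R1 < degree f1" "R2 \<in> L" "degree R2 < degree f2"
      using degree_f by (auto simp: L_below_def)
    from crt_surjective[OF R(1,3)] obtain H where
      H: "H \<in> L" "H - R1 \<in> left_ideal q f1" "H - R2 \<in> left_ideal q f2" by blast
    \<comment> \<open>Reducing \<open>H\<close> modulo \<open>M\<close> lowers the degree and keeps
      both residues, since the left ideal of \<open>M\<close> lies in those of \<open>f1\<close> and
      \<open>f2\<close>.\<close>
    obtain Q P where P: "Q \<in> L" "P \<in> L" "degree P < degree M" "H = Q \<circ>\<^sub>p M + P"
      using right_division_exists[OF H(1) M_L M0] by blast
    have "H - P \<in> left_ideal q M" using P by (auto simp: left_ideal_iff)
    then have HP: "H - P \<in> left_ideal q f1" "H - P \<in> left_ideal q f2" using ideal by auto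
    have "P - R1 \<in> left_ideal q f1" "P - R2 \<in> left_ideal q f2"
      using left_ideal_diff[OF H(2) HP(1)] left_ideal_diff[OF H(3) HP(2)] by simp_all
    then obtain Q1 Q2 where Q: "Q1 \<in> L" "P = Q1 \<circ>\<^sub>p f1 + R1" "Q2 \<in> L" "P = Q2 \<circ>\<^sub>p f2 + R2"
      unfolding left_ideal_iff diff_eq_eq by blast
    have "right_rem q P f1 = R1" "right_rem q P f2 = R2"
      using R f_L Q by (metis right_rem_eqI)+
    moreover have "P \<in> L_below e" using P e by (simp add: L_below_def)
    ultimately show "(R1, R2) \<in> ?rems ` L_below e" by force
  qed
  then have "card (L_below d1 \<times> L_below d2) \<le> card (L_below e)"
    using card_L_below(1)[OF fin] by (meson card_image_le card_mono finite_imageI le_trans)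
  then have "CARD('a) ^ (d1 + d2) \<le> CARD('a) ^ e"
    by (simp add: card_cartesian_product card_L_below(2)[OF fin] power_add)
  \<comment> \<open>A base above 1, from the distinct elements 0 and 1, lets the exponents be
    compared.\<close>
  moreover have "CARD('a) > 1"
    using fin card_mono[OF fin, of "{0, 1}"] by simp
  ultimately have "d1 + d2 \<le> e" by simp
  then show ?thesis by (simp add: e)
qed

text \<open>The dividend is congruent to \<open>g\<close> modulo the lclm, and \<open>g\<close> has
  smaller degree than the lclm by \<open>degree_lclm_ge\<close>, so \<open>g\<close> is the
  remainder.\<close>

lemma crt_reconstruction:
  assumes fin: "finite (UNIV :: 'a set)" and g: "g \<in> L" "degree g < q ^ (d1 + d2)"
  shows "right_rem q
    (right_rem q g f2 \<circ>\<^sub>p (S1 \<circ>\<^sub>p f1) + right_rem q g f1 \<circ>\<^sub>p (S2 \<circ>\<^sub>p f2)) (lclm q f1 f2) = g"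
    (is "right_rem q ?H ?M = g")
proof -
  have M: "is_lclm q ?M f1 f2" using f_L by (rule is_lclm_lclm)
  then have "?H - g \<in> left_ideal q ?M"
    using crt_congruent[OF g(1)] by (simp add: is_lclm_def)
  then obtain Q where "Q \<in> L" "?H - g = Q \<circ>\<^sub>p ?M" unfolding left_ideal_iff by blast
  then show ?thesis
    using M g degree_lclm_ge[OF fin M] by (intro right_rem_eqI) (auto simp: is_lclm_def diff_eq_eq)
qed

end

theorem theorem10:
  fixes q m d1 d2 :: nat
    and f1 f2 S1 S2 g :: "'a::{field, finite} poly"
  assumes "primepow q" and "m \<ge> 1" and "CARD('a) = q ^ m"
    and "f1 \<in> linearized q" and "f2 \<in> linearized q"
    and "right_coprime q f1 f2"
    and "qdeg q f1 = ereal (real d1)" and "qdeg q f2 = ereal (real d2)"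
    and "S1 \<in> linearized q" and "S2 \<in> linearized q"
    and "S1 \<circ>\<^sub>p f1 + S2 \<circ>\<^sub>p f2 = [:0, 1:]"
    and "qdeg q S1 < ereal (real d2)" and "qdeg q S2 < ereal (real d1)"
    and "g \<in> linearized q"
    and "qdeg q g < ereal (real (d1 + d2))"
  shows "right_rem q
           (right_rem q g f2 \<circ>\<^sub>p S1 \<circ>\<^sub>p f1 + right_rem q g f1 \<circ>\<^sub>p S2 \<circ>\<^sub>p f2)
           (lclm q f1 f2) = g"
proof -
  obtain p k where p: "prime p" "k > 0" "q = p ^ k"
    using assms(1) unfolding primepow_def by blast
  have prime: "prime CHAR('a)"
    using finite_imp_CHAR_pos[where ?'a = 'a] prime_CHAR_semidom[where ?'a = 'a] by simp
  \<comment> \<open>The characteristic is a prime dividing the field order, a power of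
    \<open>p\<close>, hence it is \<open>p\<close> itself.\<close>
  have "CHAR('a) dvd p ^ (k * m)"
    using CHAR_dvd_CARD[where ?'a = 'a] assms(3) p(3) by (simp add: power_mult)
  then have "CHAR('a) = p"
    using prime p(1) by (metis prime_dvd_power primes_dvd_imp_eq)
  then interpret linearized_ring q k "TYPE('a)"
    using prime p by unfold_locales auto
  interpret linearized_bezout q k "TYPE('a)" f1 f2 S1 S2 d1 d2
    using assms by unfold_locales (auto simp: qdeg_eq_iff)
  show ?thesis
    using crt_reconstruction[of g] assms(14,15) qdeg_less_iff[of g "d1 + d2"]
    by (simp add: pcompose_assoc)
qed

end
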